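(* Let $E$ be an arbitrary directed graph. The following conditions are equivalent. (1) No element of $F_E^\Gamma$ is aperiodic. (2) The graph $E$ is no-exit, i.e. it satisfies Condition (NE): every vertex $v$ of every cycle emits just one edge.
   Context: Setup. $\Gamma=\{x^n\mid n\in\mathbb Z\}$ is the infinite cyclic group generated by $x$. $E$ is an arbitrary directed graph with vertex set $E^0$, edge set $E^1$, source map $\mathbf s$ and range map $\mathbf r$. A vertex $v$ is regular if $\mathbf s^{-1}(v)$ is finite and nonempty, and an infinite emitter if $\mathbf s^{-1}(v)$ is infinite. For every infinite emitter $v$ and every finite nonempty $Z\subseteq \mathbf s^{-1}(v)$ introduce a symbol $q_Z=q_Z^v$, called an improper vertex; elements of $E^0$ are called proper vertices. $F_E^\Gamma$ is the free commutative $\Gamma$-monoid on all proper and improper vertices (these are called the generators): its elements are finite formal sums of monomials $x^m g$ ($m\in\mathbb Z$, $g$ a generator), and $x^n$ acts by $x^n(x^m g)=x^{n+m}g$. The relation $\to_1$ on $F_E^\Gamma-\{0\}$ is given, for all $a\in F_E^\Gamma$ and $m\in\mathbb Z$, by: (A1) $a+x^m v\to_1 a+\sum_{e\in \mathbf s^{-1}(v)}x^{m+1}\mathbf r(e)$ for $v$ regular; (A2) $a+x^m v\to_1 a+x^m q_Z+\sum_{e\in Z}x^{m+1}\mathbf r(e)$ for $v$ an infinite emitter and $Z\subseteq \mathbf s^{-1}(v)$ finite and nonempty; (A3) $a+x^m q_Z\to_1 a+x^m q_W+\sum_{e\in W-Z}x^{m+1}\mathbf r(e)$ for $v$ an infinite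 emitter and finite nonempty $Z\subsetneq W\subseteq \mathbf s^{-1}(v)$. $\sim$ is the congruence on $F_E^\Gamma$ generated by $\to_1$. For $a,b\in F_E^\Gamma$, $a\precsim b$ means that $a+c\sim b$ for some $c\in F_E^\Gamma$; $b\succ a$ means $a\precsim b$ and not $a\sim b$. An element $a$ is aperiodic if $a\succ x^n a$ for some positive integer $n$. A cycle is a closed path $e_1\cdots e_n$, $n\geq 1$, with $\mathbf s(e_i)\neq \mathbf s(e_j)$ for $i\ne j$. *)

theory Defs
  imports "HOL-Library.Multiset" "Graph_Theory.Arc_Walk"
begin

(* A directed graph E is a wf_digraph G of Graph_Theory: verts G, arcs G, tail G and head G are
   E^0, E^1, s and r, and out_arcs G v is the preimage of v under s. Nothing is assumed finite, and
   loops and parallel arcs are allowed. *)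

definition regular_vertex :: "('v, 'e) pre_digraph \<Rightarrow> 'v \<Rightarrow> bool" where
  "regular_vertex G v \<longleftrightarrow> v \<in> verts G \<and> finite (out_arcs G v) \<and> out_arcs G v \<noteq> {}"

definition infinite_emitter :: "('v, 'e) pre_digraph \<Rightarrow> 'v \<Rightarrow> bool" where
  "infinite_emitter G v \<longleftrightarrow> v \<in> verts G \<and> infinite (out_arcs G v)"

(* Improper v Z is the symbol q_Z^v. The type also has junk values (Improper v Z with Z infinite,
   say); the actual generators are singled out by the set generators. *)
datatype ('v, 'e) generator = Proper 'v | Improper 'v "'e set"

definition generators :: "('v, 'e) pre_digraph \<Rightarrow> ('v, 'e) generator set" where
  "generators G = Proper ` verts G \<union>
     {Improper v Z | v Z. infinite_emitter G v \<and> finite Z \<and> Z \<noteq> {} \<and> Z \<subseteq> out_arcs G v}"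

(* The pair (m, g) is the monomial x^m g; a finite formal sum of monomials is a multiset of such
   pairs, so that + and 0 are those of multisets. *)
type_synonym ('v, 'e) formal_sum = "(int \<times> ('v, 'e) generator) multiset"

(* The carrier of the free commutative Gamma-monoid. *)
definition free_monoid :: "('v, 'e) pre_digraph \<Rightarrow> ('v, 'e) formal_sum set" where
  "free_monoid G = {a. \<forall>(m, g) \<in># a. g \<in> generators G}"

(* The action of x^n. *)
definition act :: "int \<Rightarrow> ('v, 'e) formal_sum \<Rightarrow> ('v, 'e) formal_sum" where
  "act n a = image_mset (\<lambda>(m, g). (n + m, g)) a"

(* The sum of x^m r(e) over e in Z. Only used for finite Z: mset_set is empty on infinite sets. *)
definition range_sum :: "('v, 'e) pre_digraph \<Rightarrow> int \<Rightarrow> 'e set \<Rightarrow> ('v, 'e) formal_sum" where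
  "range_sum G m Z = (\<Sum>e\<in>Z. {#(m, Proper (head G e))#})"

inductive step :: "('v, 'e) pre_digraph \<Rightarrow> ('v, 'e) formal_sum \<Rightarrow> ('v, 'e) formal_sum \<Rightarrow> bool"
  for G :: "('v, 'e) pre_digraph" where
  A1: "a \<in> free_monoid G \<Longrightarrow> regular_vertex G v \<Longrightarrow>
       step G (a + {#(m, Proper v)#}) (a + range_sum G (m + 1) (out_arcs G v))"
| A2: "a \<in> free_monoid G \<Longrightarrow> infinite_emitter G v \<Longrightarrow>
       finite Z \<Longrightarrow> Z \<noteq> {} \<Longrightarrow> Z \<subseteq> out_arcs G v \<Longrightarrow>
       step G (a + {#(m, Proper v)#}) (a + {#(m, Improper v Z)#} + range_sum G (m + 1) Z)"
| A3: "a \<in> free_monoid G \<Longrightarrow> infinite_emitter G v \<Longrightarrow>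
       finite W \<Longrightarrow> Z \<noteq> {} \<Longrightarrow> Z \<subset> W \<Longrightarrow> W \<subseteq> out_arcs G v \<Longrightarrow>
       step G (a + {#(m, Improper v Z)#})
              (a + {#(m, Improper v W)#} + range_sum G (m + 1) (W - Z))"

(* The congruence of Gamma-monoids generated by step. Since step is invariant under the action, the
   monoid congruence it generates is the same relation. *)
inductive mcong :: "('v, 'e) pre_digraph \<Rightarrow> ('v, 'e) formal_sum \<Rightarrow> ('v, 'e) formal_sum \<Rightarrow> bool"
  for G :: "('v, 'e) pre_digraph" where
  step: "step G a b \<Longrightarrow> mcong G a b"
| refl: "a \<in> free_monoid G \<Longrightarrow> mcong G a a"
| sym: "mcong G a b \<Longrightarrow> mcong G b a"
| trans: "mcong G a b \<Longrightarrow> mcong G b c \<Longrightarrow> mcong G a c"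
| add: "mcong G a b \<Longrightarrow> c \<in> free_monoid G \<Longrightarrow> mcong G (a + c) (b + c)"
| act: "mcong G a b \<Longrightarrow> mcong G (act n a) (act n b)"

definition precsim :: "('v, 'e) pre_digraph \<Rightarrow> ('v, 'e) formal_sum \<Rightarrow> ('v, 'e) formal_sum \<Rightarrow> bool" where
  "precsim G a b \<longleftrightarrow> (\<exists>c \<in> free_monoid G. mcong G (a + c) b)"

definition succ_strict :: "('v, 'e) pre_digraph \<Rightarrow> ('v, 'e) formal_sum \<Rightarrow> ('v, 'e) formal_sum \<Rightarrow> bool" where
  "succ_strict G b a \<longleftrightarrow> precsim G a b \<and> \<not> mcong G a b"

definition aperiodic :: "('v, 'e) pre_digraph \<Rightarrow> ('v, 'e) formal_sum \<Rightarrow> bool" where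
  "aperiodic G a \<longleftrightarrow> (\<exists>n::nat. n > 0 \<and> succ_strict G a (act (int n) a))"

(* The vertices of a cycle are the sources of its arcs. *)
definition no_exit :: "('v, 'e) pre_digraph \<Rightarrow> bool" where
  "no_exit G \<longleftrightarrow>
     (\<forall>p. pre_digraph.cycle G p \<longrightarrow> (\<forall>v \<in> tail G ` set p. \<exists>!e. e \<in> out_arcs G v))"

(* The library's cycle requires the targets of the arcs to be distinct; for closed walks this is
   the same as distinct sources. *)
lemma (in wf_digraph) cycle_iff_distinct_tails:
  "cycle p \<longleftrightarrow> closed_w p \<and> distinct (map (tail G) p)"
proof (cases p)
  case Nil
  then show ?thesis by (simp add: cycle_def closed_w_def)
next
  case (Cons e es)
  have "distinct (tl (awalk_verts u p)) \<longleftrightarrow> distinct (map (tail G) p)" if "awalk u p u" for u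
  proof -
    have cas: "cas u p u" using that by (simp add: awalk_def)
    have gen: "awalk_verts a q = map (tail G) q @ [b]" if "cas a q b" for a b q
      using that by (induction q arbitrary: a) auto
    have "tl (awalk_verts u p) = map (tail G) es @ [tail G e]"
      using gen[OF cas] cas Cons by simp
    then show ?thesis using Cons by auto
  qed
  then show ?thesis using Cons by (auto simp: cycle_def closed_w_def)
qed

lemma act_in_free_monoid: "a \<in> free_monoid G \<Longrightarrow> act n a \<in> free_monoid G"
  by (fastforce simp: free_monoid_def act_def)

lemma step_in_free_monoid:
  assumes "wf_digraph G" "step G a b"
  shows "a \<in> free_monoid G \<and> b \<in> free_monoid G"
proof -
  have range: "range_sum G m Z \<in> free_monoid G" if "finite Z" "Z \<subseteq> out_arcs G v" for m Z v
    using that assms(1)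
    by (induction Z rule: finite_induct)
       (auto simp: range_sum_def free_monoid_def generators_def wf_digraph.head_in_verts)
  have plus: "a + b \<in> free_monoid G" if "a \<in> free_monoid G" "b \<in> free_monoid G" for a b
    using that by (auto simp: free_monoid_def)
  have mono: "add_mset (m, g) a \<in> free_monoid G"
    if "g \<in> generators G" "a \<in> free_monoid G" for m g a
    using that by (simp add: free_monoid_def)
  show ?thesis using assms(2)
  proof cases
    case (A1 a v m)
    then show ?thesis
      by (auto intro!: plus mono range simp: regular_vertex_def generators_def)
  next
    case (A2 a v Z m)
    then show ?thesis
      by (auto intro!: plus mono range[of _ v] simp: infinite_emitter_def generators_def)
  next
    case (A3 a v W Z m)
    then have "finite Z" "Z \<subseteq> out_arcs G v" "W - Z \<subseteq> out_arcs G v" "W \<noteq> {}"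
      by (auto intro: finite_subset)
    with A3 show ?thesis
      by (auto intro!: plus mono range[of _ v] simp: generators_def simp del: in_out_arcs_conv)
  qed
qed

lemma mcong_in_free_monoid:
  assumes "wf_digraph G" "mcong G a b"
  shows "a \<in> free_monoid G \<and> b \<in> free_monoid G"
  using assms(2)
proof induction
  case (step a b)
  then show ?case using step_in_free_monoid[OF assms(1)] by blast
next
  case (add a b c)
  then show ?case by (auto simp: free_monoid_def)
qed (auto intro: act_in_free_monoid)

end

theory Submission
  imports Defs
begin

text \<open>
  A relation \<open>a + b \<sim> a\<close> involves only finitely many monomials and edges, so every
  assignment of positive integers to the vertex monomials that is compatible with those
  finitely many expansions gives \<open>a + b\<close> and \<open>a\<close> the same weight, and \<open>b\<close> must be \<open>0\<close>. Such an
  assignment always exists by downward recursion on the degree, since expansion raises the degree.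
  If the graph is no-exit, there is even one that does not depend on the degree: it is \<open>1\<close> on cycles,
  and the remaining vertices expand acyclically. It then gives \<open>a\<close> and \<open>x\<^sup>n a\<close> the same
  weight, so \<open>x\<^sup>n a + c \<sim> a\<close> forces \<open>c = 0\<close>. Conversely, a vertex \<open>v\<close> on a cycle with an exit
  satisfies \<open>v \<sim> x\<^sup>n v + b\<close> with \<open>b \<noteq> 0\<close>, so \<open>v \<sim> x\<^sup>n v\<close> would contradict the first observation.
\<close>

section \<open>Positive solutions of expansion equations\<close>

text \<open>Here \<open>Z p\<close> is the set of edges expanded at \<open>p\<close>,
  \<open>h\<close> gives their targets, and \<open>\<delta>\<close> is a constant term. Positivity
  follows by induction along \<open>R\<close>, since each equation has a positive constant term or a
  nonempty sum. It serves both graded vertices \<open>(m, v)\<close> and plain vertices.\<close>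

lemma positive_weights_exist:
  fixes \<delta> :: "'p \<Rightarrow> nat" and Z :: "'p \<Rightarrow> 'e set" and h :: "'p \<Rightarrow> 'e \<Rightarrow> 'p"
  assumes "wf R"
    and "\<And>p. p \<in> P \<Longrightarrow> finite (Z p)"
    and "\<And>p. p \<in> P \<Longrightarrow> \<delta> p > 0 \<or> Z p \<noteq> {}"
    and desc: "\<And>p e. p \<in> P \<Longrightarrow> e \<in> Z p \<Longrightarrow> (h p e, p) \<in> R"
  obtains f :: "'p \<Rightarrow> nat" where "\<And>p. f p > 0"
    and "\<And>p. p \<notin> P \<Longrightarrow> f p = 1"
    and "\<And>p. p \<in> P \<Longrightarrow> f p = \<delta> p + (\<Sum>e\<in>Z p. f (h p e))"
proof
  \<comment> \<open>The default 1 outside \<open>P\<close> later becomes the weight of vertices on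
    cycles.\<close>
  define f where "f = wfrec R (\<lambda>f p. if p \<in> P then \<delta> p + (\<Sum>e\<in>Z p. f (h p e)) else 1)"
  have rec: "f p = (if p \<in> P then \<delta> p + (\<Sum>e\<in>Z p. f (h p e)) else 1)" for p
    unfolding f_def by (subst wfrec[OF assms(1)]) (auto simp: cut_apply desc)
  show "f p = 1" if "p \<notin> P" for p
    using that rec[of p] by simp
  show "f p = \<delta> p + (\<Sum>e\<in>Z p. f (h p e))" if "p \<in> P" for p
    using that rec[of p] by simp
  show "f p > 0" for p
    using \<open>wf R\<close>
  proof (induction p rule: wf_induct_rule)
    case (less p)
    show ?case
    proof (cases "p \<in> P")
      case True
      have "(\<Sum>e\<in>Z p. f (h p e)) > 0" if "Z p \<noteq> {}"
        using that True assms(2) desc less.IH by (intro sum_pos) auto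
      then show ?thesis
        using True assms(3)[of p] rec[of p] by (cases "Z p = {}") simp_all
    qed (use rec[of p] in simp)
  qed
qed

section \<open>Weights of formal sums\<close>

text \<open>An infinite emitter is treated as if its edges in \<open>X\<close> were all it had. For
  \<open>Z\<close> inside a finite \<open>X\<close>, \<open>Improper v Z\<close> weighs what rule
  \<open>A2\<close> must leave over: one unit plus the edges of \<open>X\<close> not yet
  absorbed.\<close>

fun monomial_weight ::
  "('v, 'e) pre_digraph \<Rightarrow> 'e set \<Rightarrow> (int \<times> 'v \<Rightarrow> nat) \<Rightarrow> int \<times> ('v, 'e) generator \<Rightarrow> nat" where
  "monomial_weight G X f (m, Proper v) = f (m, v)"
| "monomial_weight G X f (m, Improper v Z) =
     1 + (\<Sum>e\<in>X \<inter> out_arcs G v - Z. f (m + 1, head G e))"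

definition weight ::
  "('v, 'e) pre_digraph \<Rightarrow> 'e set \<Rightarrow> (int \<times> 'v \<Rightarrow> nat) \<Rightarrow> ('v, 'e) formal_sum \<Rightarrow> nat" where
  "weight G X f a = (\<Sum>p\<in>#a. monomial_weight G X f p)"

text \<open>
  An infinite emitter keeps one unit for the improper vertex that has absorbed all of \<open>X\<close>. The
  equations are imposed only at the finitely many monomials in \<open>S\<close>, because no natural-valued
  \<open>f\<close> satisfies all of them in general.
\<close>
definition admissible ::
  "('v, 'e) pre_digraph \<Rightarrow> (int \<times> 'v) set \<Rightarrow> 'e set \<Rightarrow> (int \<times> 'v \<Rightarrow> nat) \<Rightarrow> bool" where
  "admissible G S X f \<longleftrightarrow> (\<forall>p. f p > 0) \<and>
     (\<forall>(m, v) \<in> S.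
        (regular_vertex G v \<longrightarrow> f (m, v) = (\<Sum>e\<in>out_arcs G v. f (m + 1, head G e))) \<and>
        (infinite_emitter G v \<longrightarrow> f (m, v) = 1 + (\<Sum>e\<in>X \<inter> out_arcs G v. f (m + 1, head G e))))"

lemma weight_empty [simp]: "weight G X f {#} = 0"
  by (simp add: weight_def)

lemma weight_union [simp]: "weight G X f (a + b) = weight G X f a + weight G X f b"
  by (simp add: weight_def)

lemma weight_add_mset [simp]:
  "weight G X f (add_mset p a) = monomial_weight G X f p + weight G X f a"
  by (simp add: weight_def)

lemma weight_range_sum [simp]:
  "weight G X f (range_sum G m Z) = (\<Sum>e\<in>Z. f (m, head G e))"
  by (induction Z rule: infinite_finite_induct) (simp_all add: range_sum_def)

lemma weight_act: "weight G X f (act n a) = weight G X (\<lambda>(m, v). f (n + m, v)) a"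
proof (induction a)
  case (add p a)
  obtain m g where "p = (m, g)" by (cases p)
  with add show ?case by (cases g) (simp_all add: act_def algebra_simps)
qed (simp add: act_def)

lemma admissible_shift:
  assumes "admissible G ((\<lambda>(m, v). (n + m, v)) ` S) X f"
  shows "admissible G S X (\<lambda>(m, v). f (n + m, v))"
  using assms by (auto simp: admissible_def algebra_simps)

lemma admissible_mono: "admissible G S X f \<Longrightarrow> S' \<subseteq> S \<Longrightarrow> admissible G S' X f"
  by (auto simp: admissible_def)

lemma weight_eq_0_imp_empty:
  assumes "admissible G S X f" "weight G X f a = 0"
  shows "a = {#}"
proof (rule ccontr)
  assume "a \<noteq> {#}"
  then obtain m g b where "a = add_mset (m, g) b"
    by (metis multiset_cases surj_pair)
  moreover have "f p > 0" for p
    using assms(1) unfolding admissible_def by blast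
  ultimately show False
    using assms(2) by (cases g) (simp_all add: less_numeral_extra(3) flip: neq0_conv)
qed

section \<open>Invariance of weights under the congruence\<close>

text \<open>\<open>A1\<close> and \<open>A2\<close> each use the single equation at the expanded
  monomial. \<open>A3\<close> needs no equation: the weights of the two improper vertices differ
  exactly by the edges in \<open>W - Z\<close>.\<close>

lemma step_weight_eq:
  fixes G :: "('v, 'e) pre_digraph"
  assumes "step G a b"
  obtains S X where "finite S" "finite X"
    "\<And>X' f. admissible G S X' f \<Longrightarrow> finite X' \<Longrightarrow> X \<subseteq> X' \<Longrightarrow> weight G X' f a = weight G X' f b"
  using assms
proof cases
  case (A1 c v m)
  show ?thesis
    by (rule that[of "{(m, v)}" "{}"]) (use A1 in \<open>auto simp: admissible_def\<close>)
next
  case (A2 c v Z m)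
  show ?thesis
  proof (rule that[of "{(m, v)}" Z])
    fix X' and f :: "int \<times> 'v \<Rightarrow> nat"
    assume adm: "admissible G {(m, v)} X' f" and X': "finite X'" "Z \<subseteq> X'"
    have "(\<Sum>e\<in>X' \<inter> out_arcs G v. f (m + 1, head G e)) =
        (\<Sum>e\<in>X' \<inter> out_arcs G v - Z. f (m + 1, head G e)) + (\<Sum>e\<in>Z. f (m + 1, head G e))"
      using A2 X' by (intro sum.subset_diff) auto
    then show "weight G X' f a = weight G X' f b"
      using A2 adm by (simp add: admissible_def)
  qed (use A2 in auto)
next
  case (A3 c v W Z m)
  show ?thesis
  proof (rule that[of "{}" W])
    fix X' and f :: "int \<times> 'v \<Rightarrow> nat"
    assume X': "finite X'" "W \<subseteq> X'"
    have "X' \<inter> out_arcs G v - Z - (W - Z) = X' \<inter> out_arcs G v - W"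
      using A3 by auto
    then have "(\<Sum>e\<in>X' \<inter> out_arcs G v - Z. f (m + 1, head G e)) =
        (\<Sum>e\<in>X' \<inter> out_arcs G v - W. f (m + 1, head G e)) + (\<Sum>e\<in>W - Z. f (m + 1, head G e))"
      using A3 X' by (subst sum.subset_diff[of "W - Z"]) auto
    then show "weight G X' f a = weight G X' f b"
      using A3 by simp
  qed (use A3 in auto)
qed

text \<open>Induction on the derivation collects the finitely many equations and edges it uses.
  Allowing every finite \<open>X'\<close> above \<open>X\<close> lets the two halves of a
  transitivity step share one weight.\<close>

lemma mcong_weight_eq:
  fixes G :: "('v, 'e) pre_digraph"
  assumes "mcong G a b"
  obtains S X where "finite S" "finite X"
    "\<And>X' f. admissible G S X' f \<Longrightarrow> finite X' \<Longrightarrow> X \<subseteq> X' \<Longrightarrow> weight G X' f a = weight G X' f b"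
  using assms
proof (induction arbitrary: thesis)
  case (step a b)
  then show ?case by (metis step_weight_eq)
next
  case (refl a)
  show ?case by (rule refl(2)[of "{}" "{}"]) auto
next
  case (sym a b)
  then show ?case by metis
next
  case (trans a b c)
  from trans.IH(1) obtain S X where 1: "finite S" "finite X"
    "\<And>X' f. admissible G S X' f \<Longrightarrow> finite X' \<Longrightarrow> X \<subseteq> X' \<Longrightarrow> weight G X' f a = weight G X' f b"
    by blast
  from trans.IH(2) obtain T Y where 2: "finite T" "finite Y"
    "\<And>X' f. admissible G T X' f \<Longrightarrow> finite X' \<Longrightarrow> Y \<subseteq> X' \<Longrightarrow> weight G X' f b = weight G X' f c"
    by blast
  show ?case
  proof (rule trans.prems[of "S \<union> T" "X \<union> Y"])
    fix X' and f :: "int \<times> 'v \<Rightarrow> nat"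
    assume "admissible G (S \<union> T) X' f" "finite X'" "X \<union> Y \<subseteq> X'"
    then show "weight G X' f a = weight G X' f c"
      using 1(3)[of X' f] 2(3)[of X' f] by (metis Un_subset_iff admissible_mono sup_ge1 sup_ge2)
  qed (use 1 2 in auto)
next
  case (add a b c)
  from add.IH obtain S X where 1: "finite S" "finite X"
    "\<And>X' f. admissible G S X' f \<Longrightarrow> finite X' \<Longrightarrow> X \<subseteq> X' \<Longrightarrow> weight G X' f a = weight G X' f b"
    by blast
  show ?case
    by (rule add.prems[of S X]) (use 1 in auto)
next
  case (act a b n)
  from act.IH obtain S X where 1: "finite S" "finite X"
    "\<And>X' f. admissible G S X' f \<Longrightarrow> finite X' \<Longrightarrow> X \<subseteq> X' \<Longrightarrow> weight G X' f a = weight G X' f b"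
    by blast
  show ?case
    \<comment> \<open>Acting by \<open>n\<close> amounts to shifting \<open>f\<close>, so the
      equations are required at the shifted monomials.\<close>
    by (rule act.prems[of "(\<lambda>(m, v). (n + m, v)) ` S" X])
       (use 1 in \<open>auto simp: weight_act dest: admissible_shift\<close>)
qed

section \<open>Cancellation in arbitrary graphs\<close>

lemma admissible_exists:
  fixes G :: "('v, 'e) pre_digraph"
  assumes "finite S" "finite X"
  obtains f where "admissible G S X f"
proof -
  obtain N where N: "\<And>m v. (m, v) \<in> S \<Longrightarrow> m \<le> N"
  proof
    show "m \<le> Max (fst ` S)" if "(m, v) \<in> S" for m v
      using that assms(1) by (intro Max_ge) force+
  qed
  define P where "P = {(m, v) \<in> S. regular_vertex G v \<or> infinite_emitter G v}"
  define Z where "Z p = (if regular_vertex G (snd p) then out_arcs G (snd p)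
    else X \<inter> out_arcs G (snd p))" for p :: "int \<times> 'v"
  \<comment> \<open>The constant 1 is needed at infinite emitters, where \<open>X\<close> may
    contain no outgoing edge; a regular vertex always has one.\<close>
  define \<delta> :: "int \<times> 'v \<Rightarrow> nat" where "\<delta> p = (if regular_vertex G (snd p) then 0 else 1)" for p
  obtain f where f: "\<And>p. f p > 0"
    "\<And>p. p \<in> P \<Longrightarrow> f p = \<delta> p + (\<Sum>e\<in>Z p. f (fst p + 1, head G e))"
  \<comment> \<open>Targets have degree one higher and degrees in \<open>S\<close> are at most
    \<open>N\<close>; the \<open>+ 1\<close> keeps the descent strict at degree
    \<open>N\<close>.\<close>
  proof (rule positive_weights_exist[of "measure (\<lambda>(m, v). nat (N + 1 - m))" P Z \<delta>
        "\<lambda>p e. (fst p + 1, head G e)"])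
    show "finite (Z p)" for p
      using assms by (auto simp: Z_def regular_vertex_def)
    show "\<delta> p > 0 \<or> Z p \<noteq> {}" for p
      by (auto simp: Z_def \<delta>_def regular_vertex_def)
    show "((fst p + 1, head G e), p) \<in> measure (\<lambda>(m, v). nat (N + 1 - m))" if "p \<in> P" for p e
      using that N by (force simp: P_def)
  qed auto
  have "admissible G S X f"
    unfolding admissible_def
  proof (intro conjI allI ballI)
    fix p
    assume "p \<in> S"
    show "case p of (m, v) \<Rightarrow>
        (regular_vertex G v \<longrightarrow> f (m, v) = (\<Sum>e\<in>out_arcs G v. f (m + 1, head G e))) \<and>
        (infinite_emitter G v \<longrightarrow> f (m, v) = 1 + (\<Sum>e\<in>X \<inter> out_arcs G v. f (m + 1, head G e)))"
    proof (clarify, intro conjI impI)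
      fix m v
      assume p: "p = (m, v)"
      show "f (m, v) = (\<Sum>e\<in>out_arcs G v. f (m + 1, head G e))" if "regular_vertex G v"
        using that \<open>p \<in> S\<close> p f(2)[of p] by (simp add: P_def Z_def \<delta>_def)
      show "f (m, v) = 1 + (\<Sum>e\<in>X \<inter> out_arcs G v. f (m + 1, head G e))"
        if "infinite_emitter G v"
      proof -
        have "\<not> regular_vertex G v"
          using that by (simp add: regular_vertex_def infinite_emitter_def)
        then show ?thesis
          using that \<open>p \<in> S\<close> p f(2)[of p] by (simp add: P_def Z_def \<delta>_def)
      qed
    qed
  qed (rule f(1))
  then show ?thesis by (rule that)
qed

lemma mcong_add_self_imp_empty:
  assumes "mcong G (a + b) a"
  shows "b = {#}"
proof -
  obtain S X where 1: "finite S" "finite X"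
    "\<And>X' f. admissible G S X' f \<Longrightarrow> finite X' \<Longrightarrow> X \<subseteq> X' \<Longrightarrow>
      weight G X' f (a + b) = weight G X' f a"
    using assms by (rule mcong_weight_eq) blast
  obtain f where f: "admissible G S X f"
    using 1 by (metis admissible_exists)
  show ?thesis
    using 1(3)[OF f \<open>finite X\<close>] weight_eq_0_imp_empty[OF f] by simp
qed

section \<open>Aperiodic elements from exits\<close>

context wf_digraph
begin

text \<open>For finitely many edges, \<open>b\<close> collects the targets of the edges other than
  \<open>e\<close>. For an infinite emitter, \<open>A2\<close> with \<open>Z = {e}\<close> leaves an
  improper vertex, so \<open>b\<close> is nonzero.\<close>

lemma mcong_arc:
  assumes "e \<in> arcs G"
  obtains b where "b \<in> free_monoid G"
    "mcong G {#(m, Proper (tail G e))#} ({#(m + 1, Proper (head G e))#} + b)"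
    "out_arcs G (tail G e) \<noteq> {e} \<Longrightarrow> b \<noteq> {#}"
proof -
  let ?u = "tail G e"
  have u: "?u \<in> verts G" "e \<in> out_arcs G ?u"
    using assms by auto
  have "\<exists>b. step G {#(m, Proper ?u)#} ({#(m + 1, Proper (head G e))#} + b) \<and>
      (out_arcs G ?u \<noteq> {e} \<longrightarrow> b \<noteq> {#})"
  proof (cases "finite (out_arcs G ?u)")
    case True
    then have "regular_vertex G ?u"
      using u by (auto simp: regular_vertex_def)
    then have "step G ({#} + {#(m, Proper ?u)#}) ({#} + range_sum G (m + 1) (out_arcs G ?u))"
      by (intro step.A1) (auto simp: free_monoid_def)
    moreover have "range_sum G (m + 1) (out_arcs G ?u) =
        {#(m + 1, Proper (head G e))#} + range_sum G (m + 1) (out_arcs G ?u - {e})"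
      unfolding range_sum_def using True u(2) by (rule sum.remove)
    moreover have "range_sum G (m + 1) (out_arcs G ?u - {e}) \<noteq> {#}" if ne: "out_arcs G ?u \<noteq> {e}"
    proof -
      obtain d where "d \<in> out_arcs G ?u - {e}"
        using ne u(2) by blast
      then show ?thesis
        using True by (simp add: range_sum_def sum.remove[of _ d] del: in_out_arcs_conv)
    qed
    ultimately show ?thesis by auto
  next
    case False
    then have "step G ({#} + {#(m, Proper ?u)#})
        ({#} + {#(m, Improper ?u {e})#} + range_sum G (m + 1) {e})"
      using u by (intro step.A2) (auto simp: free_monoid_def infinite_emitter_def)
    then show ?thesis
      by (intro exI[of _ "{#(m, Improper ?u {e})#}"]) (simp add: range_sum_def add_mset_commute)
  qed
  then obtain b where b: "step G {#(m, Proper ?u)#} ({#(m + 1, Proper (head G e))#} + b)"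
    "out_arcs G ?u \<noteq> {e} \<longrightarrow> b \<noteq> {#}"
    by blast
  moreover have "b \<in> free_monoid G"
    using step_in_free_monoid[OF wf_digraph_axioms b(1)] by (simp add: free_monoid_def)
  ultimately show ?thesis
    using that mcong.step by blast
qed

lemma mcong_awalk:
  assumes "awalk u p w"
  shows "\<exists>b \<in> free_monoid G.
    mcong G {#(m, Proper u)#} ({#(m + int (length p), Proper w)#} + b)"
  using assms
proof (induction p arbitrary: u m)
  case Nil
  then have "{#(m, Proper w)#} \<in> free_monoid G" "u = w"
    by (auto simp: awalk_def free_monoid_def generators_def)
  then show ?case
    by (intro bexI[of _ "{#}"]) (auto intro: mcong.refl simp: free_monoid_def)
next
  case (Cons e p)
  then have e: "e \<in> arcs G" "tail G e = u" "awalk (head G e) p w"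
    by (auto simp: awalk_Cons_iff)
  obtain b where b: "b \<in> free_monoid G"
    "mcong G {#(m, Proper u)#} ({#(m + 1, Proper (head G e))#} + b)"
    using mcong_arc[OF e(1)] e(2) by metis
  obtain c where c: "c \<in> free_monoid G" "mcong G {#(m + 1, Proper (head G e))#}
      ({#(m + 1 + int (length p), Proper w)#} + c)"
    using Cons.IH[OF e(3)] by blast
  have "mcong G {#(m, Proper u)#} ({#(m + 1 + int (length p), Proper w)#} + c + b)"
    using b c by (blast intro: mcong.trans mcong.add)
  moreover have "c + b \<in> free_monoid G"
    using b c by (auto simp: free_monoid_def)
  ultimately show ?case
    by (intro bexI[of _ "c + b"]) (simp_all add: algebra_simps)
qed

lemma aperiodic_of_exit:
  assumes "e \<in> arcs G" "head G e \<rightarrow>\<^sup>* tail G e" "out_arcs G (tail G e) \<noteq> {e}"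
  shows "\<exists>a \<in> free_monoid G. aperiodic G a"
proof -
  let ?v = "tail G e"
  let ?a = "{#(0, Proper ?v)#} :: ('a, 'b) formal_sum"
  obtain p where p: "awalk (head G e) p ?v"
    using assms(2) by (auto simp: reachable_awalk)
  \<comment> \<open>The length of the closed walk, including \<open>e\<close> itself.\<close>
  define n where "n = Suc (length p)"
  obtain b where b: "b \<in> free_monoid G" "b \<noteq> {#}"
    "mcong G ?a ({#(0 + 1, Proper (head G e))#} + b)"
    using mcong_arc[OF assms(1)] assms(3) by metis
  obtain c where c: "c \<in> free_monoid G" "mcong G {#(0 + 1, Proper (head G e))#}
      ({#(0 + 1 + int (length p), Proper ?v)#} + c)"
    using mcong_awalk[OF p] by blast
  have "mcong G ?a ({#(0 + 1 + int (length p), Proper ?v)#} + c + b)"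
    using b c by (blast intro: mcong.trans mcong.add)
  then have a: "mcong G ?a (act (int n) ?a + (c + b))"
    by (simp add: act_def n_def add.assoc)
  have "c + b \<in> free_monoid G"
    using b c by (auto simp: free_monoid_def)
  then have "precsim G (act (int n) ?a) ?a"
    unfolding precsim_def using a by (blast intro: mcong.sym)
  \<comment> \<open>Otherwise \<open>x^n v\<close> would absorb \<open>c + b\<close>, although
    \<open>b\<close> is nonzero.\<close>
  moreover have "\<not> mcong G (act (int n) ?a) ?a"
  proof
    assume "mcong G (act (int n) ?a) ?a"
    then have "mcong G (act (int n) ?a + (c + b)) (act (int n) ?a)"
      using a by (blast intro: mcong.sym mcong.trans)
    then show False
      using mcong_add_self_imp_empty b(2) by fastforce
  qed
  ultimately have "aperiodic G ?a"
    unfolding aperiodic_def succ_strict_def n_def by blast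
  then show ?thesis
    using mcong_in_free_monoid[OF wf_digraph_axioms a] by blast
qed

lemma cycle_arc_reachable:
  assumes "cycle p" "e \<in> set p"
  shows "e \<in> arcs G" "head G e \<rightarrow>\<^sup>* tail G e"
proof -
  obtain u where "awalk u p u"
    using assms(1) by (auto simp: cycle_def)
  moreover obtain q r where "p = q @ e # r"
    using assms(2) by (meson split_list)
  ultimately have "awalk u q (tail G e)" and e: "e \<in> arcs G" and "awalk (head G e) r u"
    by (auto simp: awalk_Cons_iff)
  then show "head G e \<rightarrow>\<^sup>* tail G e"
    using reachable_awalkI reachable_trans by blast
  show "e \<in> arcs G" by (fact e)
qed

section \<open>Degree-free weights on no-exit graphs\<close>

text \<open>Shortening the way back to \<open>v\<close> to a path turns a closed walk into a cycle.
  That the target again lies on a closed walk lets the constant 1 satisfy the equation at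
  \<open>v\<close>.\<close>

lemma no_exit_out_arcs:
  assumes "no_exit G" "v \<rightarrow>\<^sup>+ v"
  obtains e where "out_arcs G v = {e}" "head G e \<rightarrow>\<^sup>+ head G e"
proof -
  obtain p where "awalk v p v" "p \<noteq> []"
    using assms(2) by (auto simp: reachable1_awalk)
  then obtain d p' where "p = d # p'" "d \<in> arcs G" "tail G d = v" "awalk (head G d) p' v"
    by (cases p) (auto simp: awalk_Cons_iff)
  then obtain w where d: "d \<in> arcs G" "tail G d = v" "head G d = w" and w: "w \<rightarrow>\<^sup>* v"
    using reachable_awalkI by blast
  obtain q where q: "apath w q v"
    using w by (auto simp: reachable_apath)
  then have "awalk v (d # q) v" "distinct (awalk_verts w q)"
    using d by (auto simp: apath_def awalk_Cons_iff)
  then have "cycle (d # q)"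
    using d by (auto simp: cycle_def)
  then have "\<exists>!e. e \<in> out_arcs G v"
    using assms(1) d unfolding no_exit_def by fastforce
  then have "out_arcs G v = {d}"
    using d by auto
  moreover have "w \<rightarrow>\<^sup>+ w"
    using w d by (metis in_arcs_imp_in_arcs_ends r_into_trancl reachable_reachable1_trans)
  ultimately show ?thesis
    using that d by blast
qed

lemma degree_free_admissible_exists:
  assumes "no_exit G" "finite S" "finite X"
  obtains g where "admissible G S X (g \<circ> snd)"
proof -
  define P where "P = {v \<in> snd ` S. (regular_vertex G v \<or> infinite_emitter G v) \<and> \<not> v \<rightarrow>\<^sup>+ v}"
  define Z where "Z v = (if regular_vertex G v then out_arcs G v else X \<inter> out_arcs G v)" for v
  define \<delta> :: "'a \<Rightarrow> nat" where "\<delta> v = (if regular_vertex G v then 0 else 1)" for v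
  \<comment> \<open>Only edges expanded at \<open>P\<close> are kept, so \<open>R\<close> is finite
    and its well-foundedness reduces to acyclicity. A cycle of \<open>R\<close> would put a vertex
    of \<open>P\<close> on a closed walk.\<close>
  define R where "R = (\<Union>v\<in>P. (\<lambda>e. (head G e, v)) ` Z v)"
  have finZ: "finite (Z v)" for v
    using assms(3) by (auto simp: Z_def regular_vertex_def)
  have arc: "v \<in> P \<and> v \<rightarrow>\<^sup>+ u" if uv: "(u, v) \<in> R" for u v
  proof -
    obtain e where "v \<in> P" "e \<in> Z v" "u = head G e"
      using uv by (auto simp: R_def)
    moreover from this have "e \<in> arcs G" "tail G e = v"
      by (auto simp: Z_def split: if_splits)
    ultimately show ?thesis
      using in_arcs_imp_in_arcs_ends by blast
  qed
  have "(u, v) \<in> R\<^sup>+ \<Longrightarrow> v \<in> P \<and> v \<rightarrow>\<^sup>+ u" for u v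
    by (induction rule: trancl_induct) (meson arc trancl_trans)+
  then have "acyclic R"
    by (auto simp: acyclic_def P_def)
  moreover have "finite R"
    using assms(2) finZ by (auto simp: R_def P_def)
  ultimately have "wf R"
    by (rule finite_acyclic_wf[rotated])
  obtain g where g: "\<And>v. g v > 0" "\<And>v. v \<notin> P \<Longrightarrow> g v = 1"
    "\<And>v. v \<in> P \<Longrightarrow> g v = \<delta> v + (\<Sum>e\<in>Z v. g (head G e))"
  proof (rule positive_weights_exist[of R P Z \<delta> "\<lambda>v e. head G e"])
    show "\<delta> v > 0 \<or> Z v \<noteq> {}" for v
      by (auto simp: Z_def \<delta>_def regular_vertex_def)
    show "(head G e, v) \<in> R" if "v \<in> P" "e \<in> Z v" for v e
      using that by (auto simp: R_def)
  qed (use \<open>wf R\<close> finZ in auto)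
  have regular: "g v = (\<Sum>e\<in>out_arcs G v. g (head G e))"
    if "(m, v) \<in> S" "regular_vertex G v" for m v
  proof (cases "v \<rightarrow>\<^sup>+ v")
    \<comment> \<open>The sum has one term, and both \<open>v\<close> and its successor lie outside
      \<open>P\<close>, hence have weight 1.\<close>
    case True
    then obtain e where "out_arcs G v = {e}" "head G e \<rightarrow>\<^sup>+ head G e"
      using no_exit_out_arcs[OF assms(1)] by blast
    then show ?thesis
      using True g(2) by (simp add: P_def)
  next
    case False
    then have "v \<in> P"
      using that by (force simp: P_def)
    then show ?thesis
      using that g(3) by (simp add: Z_def \<delta>_def)
  qed
  have infinite: "g v = 1 + (\<Sum>e\<in>X \<inter> out_arcs G v. g (head G e))"
    if "(m, v) \<in> S" "infinite_emitter G v" for m v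
  proof -
    \<comment> \<open>A vertex on a closed walk emits just one edge, so it is no infinite
      emitter.\<close>
    have "\<not> v \<rightarrow>\<^sup>+ v"
      using no_exit_out_arcs[OF assms(1)] that(2)
      by (metis finite.emptyI finite.insertI infinite_emitter_def)
    then have "v \<in> P"
      using that by (force simp: P_def)
    then show ?thesis
      using that g(3)
      by (simp add: Z_def \<delta>_def infinite_emitter_def regular_vertex_def del: in_out_arcs_conv)
  qed
  have "admissible G S X (g \<circ> snd)"
    unfolding admissible_def using g(1) regular infinite by fastforce
  then show ?thesis by (rule that)
qed

text \<open>A weight that ignores degrees agrees on \<open>act n a\<close> and \<open>a\<close>, so
  nothing is left for \<open>c\<close>.\<close>

lemma mcong_act_add_imp_empty:
  assumes "no_exit G" "mcong G (act n a + c) a"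
  shows "c = {#}"
proof -
  obtain S X where 1: "finite S" "finite X"
    "\<And>X' f. admissible G S X' f \<Longrightarrow> finite X' \<Longrightarrow> X \<subseteq> X' \<Longrightarrow>
      weight G X' f (act n a + c) = weight G X' f a"
    using assms(2) by (rule mcong_weight_eq) blast
  obtain g where g: "admissible G S X (g \<circ> snd)"
    using 1 assms(1) by (metis degree_free_admissible_exists)
  have "weight G X (g \<circ> snd) (act n a) = weight G X (g \<circ> snd) a"
    by (simp add: weight_act comp_def case_prod_unfold)
  then show ?thesis
    using 1(3)[OF g \<open>finite X\<close>] weight_eq_0_imp_empty[OF g] by simp
qed

end

theorem corollary5p6:
  fixes G :: "('v, 'e) pre_digraph"
  assumes "wf_digraph G"
  shows "(\<not> (\<exists>a \<in> free_monoid G. aperiodic G a)) \<longleftrightarrow> no_exit G"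
proof -
  interpret wf_digraph G by (fact assms)
  show ?thesis
  proof
    assume no_aperiodic: "\<not> (\<exists>a \<in> free_monoid G. aperiodic G a)"
    have "\<exists>!d. d \<in> out_arcs G (tail G e)" if "cycle p" "e \<in> set p" for p e
    proof -
      have "out_arcs G (tail G e) = {e}"
        using aperiodic_of_exit cycle_arc_reachable[OF that] no_aperiodic by blast
      then show ?thesis by (metis singleton_iff)
    qed
    then show "no_exit G"
      by (auto simp: no_exit_def simp del: in_out_arcs_conv)
  next
    assume ne: "no_exit G"
    show "\<not> (\<exists>a \<in> free_monoid G. aperiodic G a)"
    proof
      assume "\<exists>a \<in> free_monoid G. aperiodic G a"
      then obtain a n c where "mcong G (act (int n) a + c) a" "\<not> mcong G (act (int n) a) a"
        by (auto simp: aperiodic_def succ_strict_def precsim_def)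
      then show False
        using mcong_act_add_imp_empty[OF ne] by fastforce
    qed
  qed
qed

end
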